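(* For any binary operation $\ast$ on $I$ and any $t$-norm $\vartriangle$ on $I$, there exist $f,g\in\mathbf{L}$ such that $f\star g\ne f\curlywedge g$, where $\curlywedge$ is the operation determined by $\ast$ and $\vartriangle$ via $$(f\curlywedge g)(x)=\sup\{f(y)\ast g(z): y\vartriangle z=x\},\qquad x\in I.$$ In particular, $\star$ is not the convolution of any $t$-norm on $I$; that is, there is no $t$-norm $\vartriangle$ on $I$ such that $(f\star g)(x)=\sup\{f(y)\wedge g(z): y\vartriangle z=x\}$ for all $f,g\in\mathbf{L}$ and $x\in I$.
   Context: Let $I=[0,1]$ and let $\mathbf{M}$ be the set of all functions $I\to I$. Write $\wedge,\vee$ for minimum and maximum. A binary operation on $I$ is a map $I^2\to I$. A $t$-norm on $I$ is a binary operation on $I$ that is commutative, associative, increasing in each argument, and has $1$ as neutral element. A function $f\in\mathbf{M}$ is normal if $\sup_{x\in I} f(x)=1$, and convex if $f(y)\ge f(x)\wedge f(z)$ whenever $0\le x\le y\le z\le 1$. $\mathbf{L}$ is the set of all normal and convex functions in $\mathbf{M}$. $\mathbf{1}_{\{1\}}$ is the characteristic function of $\{1\}$ on $I$. For $f,g\in\mathbf{M}$: $(f\sqcap g)(x)=\sup\{f(y)\wedge g(z): y\wedge z=x\}$. Define $\barwedge$ on $\mathbf{M}$ by $(f\barwedge g)(x)=(f\sqcap g)(x)$ for $x\in[0,1)$ and $(f\barwedge g)(1)=0$. Define $\star:\mathbf{L}^2\to\mathbf{M}$ as follows: if $f=\mathbf{1}_{\{1\}}$, then $f\star g=g\star f=g$;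 if $g=\mathbf{1}_{\{1\}}$, then $f\star g=g\star f=f$; if $f\ne\mathbf{1}_{\{1\}}$ and $g\ne\mathbf{1}_{\{1\}}$, then $f\star g=f\sqcap g$ when $f(1)\wedge g(1)=1$, and $f\star g=f\barwedge g$ when $f(1)\wedge g(1)<1$. *)

theory Defs
  imports Complex_Main "HOL-Library.FuncSet"
begin

text \<open>
  A self-map of the unit interval is represented by an extensional function on \<open>{0..1}\<close>
  (\<open>undefined\<close> outside), so that HOL equality of two such functions is equality on \<open>{0..1}\<close>.
  Binary operations on the unit interval are curried and only constrained on \<open>{0..1}\<close>;
  their values elsewhere are never used.
\<close>

abbreviation unitI :: "real set" where
  "unitI \<equiv> {0..1}"

definition fun_M :: "(real \<Rightarrow> real) set" where
  "fun_M = unitI \<rightarrow>\<^sub>E unitI"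

definition binary_operation_on_I :: "(real \<Rightarrow> real \<Rightarrow> real) \<Rightarrow> bool" where
  "binary_operation_on_I B \<longleftrightarrow> (\<forall>x\<in>unitI. \<forall>y\<in>unitI. B x y \<in> unitI)"

text \<open>``Increasing'' is meant in the weak sense, as usual for t-norms (\<open>min\<close> is one).\<close>

definition t_norm :: "(real \<Rightarrow> real \<Rightarrow> real) \<Rightarrow> bool" where
  "t_norm T \<longleftrightarrow>
     binary_operation_on_I T \<and>
     (\<forall>x\<in>unitI. \<forall>y\<in>unitI. T x y = T y x) \<and>
     (\<forall>x\<in>unitI. \<forall>y\<in>unitI. \<forall>z\<in>unitI. T (T x y) z = T x (T y z)) \<and>
     (\<forall>x\<in>unitI. mono_on unitI (\<lambda>y. T x y)) \<and>
     (\<forall>y\<in>unitI. mono_on unitI (\<lambda>x. T x y)) \<and>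
     (\<forall>x\<in>unitI. T x 1 = x \<and> T 1 x = x)"

definition normal_fun :: "(real \<Rightarrow> real) \<Rightarrow> bool" where
  "normal_fun f \<longleftrightarrow> (SUP x\<in>unitI. f x) = 1"

definition convex_fun :: "(real \<Rightarrow> real) \<Rightarrow> bool" where
  "convex_fun f \<longleftrightarrow>
     (\<forall>x y z. 0 \<le> x \<and> x \<le> y \<and> y \<le> z \<and> z \<le> 1 \<longrightarrow> min (f x) (f z) \<le> f y)"

definition fun_L :: "(real \<Rightarrow> real) set" where
  "fun_L = {f \<in> fun_M. normal_fun f \<and> convex_fun f}"

definition char_one :: "real \<Rightarrow> real" where
  "char_one = (\<lambda>x\<in>unitI. if x = 1 then 1 else 0)"

text \<open>
  For \<open>f\<close>, \<open>g\<close> in \<open>fun_M\<close>, \<open>B\<close> a binary operation on the unit interval and \<open>T\<close> a t-norm,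
  the set below is bounded, and for \<open>x\<close> in \<open>unitI\<close> it is nonempty: it contains the value at
  \<open>y = x\<close>, \<open>z = 1\<close>; hence the real supremum is the supremum in the unit interval.
\<close>

definition convolution ::
  "(real \<Rightarrow> real \<Rightarrow> real) \<Rightarrow> (real \<Rightarrow> real \<Rightarrow> real) \<Rightarrow>
   (real \<Rightarrow> real) \<Rightarrow> (real \<Rightarrow> real) \<Rightarrow> real \<Rightarrow> real" where
  "convolution B T f g =
     (\<lambda>x\<in>unitI. Sup {B (f y) (g z) | y z. y \<in> unitI \<and> z \<in> unitI \<and> T y z = x})"

definition meet_conv :: "(real \<Rightarrow> real) \<Rightarrow> (real \<Rightarrow> real) \<Rightarrow> real \<Rightarrow> real" where
  "meet_conv f g = convolution min min f g"

definition barwedge :: "(real \<Rightarrow> real) \<Rightarrow> (real \<Rightarrow> real) \<Rightarrow> real \<Rightarrow> real" where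
  "barwedge f g = (meet_conv f g)(1 := 0)"

definition star_op :: "(real \<Rightarrow> real) \<Rightarrow> (real \<Rightarrow> real) \<Rightarrow> real \<Rightarrow> real" where
  "star_op f g =
     (if f = char_one then g
      else if g = char_one then f
      else if min (f 1) (g 1) = 1 then meet_conv f g
      else barwedge f g)"

end

theory Submission
  imports Defs
begin

text \<open>
  Everything is decided at the point \<open>1\<close>. A t-norm lies below the minimum, so \<open>T y z = 1\<close> forces
  \<open>y = z = 1\<close>, and the value at \<open>1\<close> of any convolution depends on \<open>f\<close> and \<open>g\<close> only through
  \<open>f 1\<close> and \<open>g 1\<close>, namely as \<open>B (f 1) (g 1)\<close> (lemma \<open>convolution_at_one\<close>).
  The operation \<open>\<star>\<close> does not have this property, because it treats \<open>\<one>\<^bsub>{1}\<^esub>\<close> as a special case.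
  Both \<open>\<one>\<^bsub>{1}\<^esub>\<close> and the constant function \<open>1\<close> take the value \<open>1\<close> at \<open>1\<close>; against a function \<open>g\<close>
  with \<open>g 1 = 1/2\<close>, the first gives \<open>g 1 = 1/2\<close>, as a neutral element, whereas the second falls into
  the truncated case and gives \<open>0\<close>. If \<open>\<star>\<close> were a convolution, both would be \<open>B 1 (1/2)\<close>.
\<close>

lemma t_norm_eq_one_iff:
  assumes "t_norm T" and "y \<in> unitI" and "z \<in> unitI"
  shows "T y z = 1 \<longleftrightarrow> y = 1 \<and> z = 1"
proof
  have "mono_on unitI (\<lambda>z. T y z)" and "mono_on unitI (\<lambda>y. T y z)"
    using assms unfolding t_norm_def by blast+
  then have "T y z \<le> T y 1" and "T y z \<le> T 1 z"
    using assms(2,3) by (auto simp: mono_on_def)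
  moreover have "T y 1 = y" and "T 1 z = z"
    using assms unfolding t_norm_def by blast+
  ultimately show "y = 1 \<and> z = 1" if "T y z = 1"
    using that assms(2,3) by auto
next
  show "T y z = 1" if "y = 1 \<and> z = 1"
    using that assms unfolding t_norm_def by blast
qed

lemma convolution_at_one:
  assumes "t_norm T"
  shows "convolution B T f g 1 = B (f 1) (g 1)"
proof -
  have "{B (f y) (g z) | y z. y \<in> unitI \<and> z \<in> unitI \<and> T y z = 1} = {B (f 1) (g 1)}"
  proof (intro set_eqI iffI)
    show "w \<in> {B (f 1) (g 1)}"
      if "w \<in> {B (f y) (g z) | y z. y \<in> unitI \<and> z \<in> unitI \<and> T y z = 1}" for w
      using that t_norm_eq_one_iff[OF assms] by blast
    have "T 1 1 = 1"
      using t_norm_eq_one_iff[OF assms, of 1 1] by simp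
    then show "w \<in> {B (f y) (g z) | y z. y \<in> unitI \<and> z \<in> unitI \<and> T y z = 1}"
      if "w \<in> {B (f 1) (g 1)}" for w
      using that by force
  qed
  then show ?thesis
    by (simp add: convolution_def)
qed

lemma normal_funI:
  assumes "f \<in> fun_M" and "x \<in> unitI" and "f x = 1"
  shows "normal_fun f"
  unfolding normal_fun_def
proof (rule cSup_eq_maximum)
  show "1 \<in> f ` unitI"
    using assms(2,3) by force
  show "y \<le> 1" if "y \<in> f ` unitI" for y
    using that assms(1) by (auto simp: fun_M_def)
qed

lemma char_one_in_fun_L: "char_one \<in> fun_L"
proof -
  have M: "char_one \<in> fun_M"
    by (auto simp: fun_M_def char_one_def)
  moreover have "normal_fun char_one"
    using M by (rule normal_funI[where x = 1]) (auto simp: char_one_def)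
  moreover have "convex_fun char_one"
    by (auto simp: convex_fun_def char_one_def)
  ultimately show ?thesis
    by (simp add: fun_L_def)
qed

text \<open>
  These functions realise every possible value \<open>c\<close> at \<open>1\<close> by an element of \<open>\<^bold>L\<close> different from
  \<open>\<one>\<^bsub>{1}\<^esub>\<close>: convexity holds because they are decreasing, and normality is secured away from \<open>1\<close>.
\<close>

definition one_until :: "real \<Rightarrow> real \<Rightarrow> real" where
  "one_until c = (\<lambda>x\<in>unitI. if x = 1 then c else 1)"

lemma one_until_at_one [simp]: "one_until c 1 = c"
  by (simp add: one_until_def)

lemma one_until_in_fun_L:
  assumes "c \<in> unitI"
  shows "one_until c \<in> fun_L"
proof -
  have M: "one_until c \<in> fun_M"
    using assms by (auto simp: fun_M_def one_until_def)
  moreover have "normal_fun (one_until c)"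
    using M by (rule normal_funI[where x = 0]) (auto simp: one_until_def)
  moreover have "convex_fun (one_until c)"
    using assms by (auto simp: convex_fun_def one_until_def)
  ultimately show ?thesis
    by (simp add: fun_L_def)
qed

lemma one_until_neq_char_one: "one_until c \<noteq> char_one"
proof
  assume "one_until c = char_one"
  then have "one_until c 0 = char_one 0"
    by simp
  then show False
    by (simp add: one_until_def char_one_def)
qed

lemma star_op_at_one_eq_0:
  assumes "f \<noteq> char_one" and "g \<noteq> char_one" and "min (f 1) (g 1) \<noteq> 1"
  shows "star_op f g 1 = 0"
  using assms by (simp add: star_op_def barwedge_def)

lemma star_op_neq_convolution_at_one:
  assumes "t_norm T"
  shows "\<exists>f\<in>fun_L. \<exists>g\<in>fun_L. star_op f g 1 \<noteq> convolution B T f g 1"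
proof (rule ccontr)
  assume "\<not> ?thesis"
  then have eq: "star_op f g 1 = B (f 1) (g 1)" if "f \<in> fun_L" "g \<in> fun_L" for f g
    using that convolution_at_one[OF assms] by metis
  let ?g = "one_until (1/2)"
  have g: "?g \<in> fun_L"
    by (rule one_until_in_fun_L) simp
  have "B 1 (1/2) = star_op char_one ?g 1"
    using eq[OF char_one_in_fun_L g] by (simp add: char_one_def)
  also have "\<dots> = 1/2"
    by (simp add: star_op_def)
  finally have "B 1 (1/2) = 1/2" .
  moreover have "B 1 (1/2) = star_op (one_until 1) ?g 1"
    using eq[OF one_until_in_fun_L g, of 1] by simp
  moreover have "star_op (one_until 1) ?g 1 = 0"
    by (rule star_op_at_one_eq_0) (simp_all add: one_until_neq_char_one)
  ultimately show False
    by simp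
qed

theorem theorem4:
  shows "(\<forall>B T. binary_operation_on_I B \<and> t_norm T \<longrightarrow>
            (\<exists>f\<in>fun_L. \<exists>g\<in>fun_L. star_op f g \<noteq> convolution B T f g))
       \<and> \<not> (\<exists>T. t_norm T \<and>
            (\<forall>f\<in>fun_L. \<forall>g\<in>fun_L. \<forall>x\<in>unitI. star_op f g x = convolution min T f g x))"
proof (intro conjI allI impI)
  fix B T
  assume "binary_operation_on_I B \<and> t_norm T"
  then show "\<exists>f\<in>fun_L. \<exists>g\<in>fun_L. star_op f g \<noteq> convolution B T f g"
    using star_op_neq_convolution_at_one[of T B] by metis
next
  show "\<not> (\<exists>T. t_norm T \<and>
            (\<forall>f\<in>fun_L. \<forall>g\<in>fun_L. \<forall>x\<in>unitI. star_op f g x = convolution min T f g x))"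
  proof
    assume "\<exists>T. t_norm T \<and>
            (\<forall>f\<in>fun_L. \<forall>g\<in>fun_L. \<forall>x\<in>unitI. star_op f g x = convolution min T f g x)"
    then obtain T where "t_norm T"
      and "\<forall>f\<in>fun_L. \<forall>g\<in>fun_L. star_op f g 1 = convolution min T f g 1"
      by auto
    then show False
      using star_op_neq_convolution_at_one[of T min] by blast
  qed
qed

end
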